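(* Let $1\le k\le n$ be integers, let $\Sigma\in\mathrm{Sym}^+(n,k)$, let $X\in\mathbb{R}^{n\times k}_*$ be such that $\Sigma=XX^\top$, and let $V\in T_\Sigma\mathrm{Sym}^+(n,k)$. Let $\Sigma=UDU^\top$ be a decomposition with $D$ a diagonal $k\times k$ matrix with positive diagonal entries and $U\in\mathrm{St}(n,k)$. Denote $S=S_{\Sigma,V}=U\,\mathcal{S}_D(U^\top VU)\,U^\top$. Then $S_{\Sigma,V}$ and $I_n-UU^\top$ are independent of the chosen decomposition, and: 1. (Tangent space) $T_\Sigma\mathrm{Sym}^+(n,k)=\{V\in\mathrm{Sym}(n): X_\perp^\top VX_\perp=0\}$. 2. (Horizontal lift) $V^\#_X=X(X^\top X)^{-1}\mathcal{S}_{X^\top X}(X^\top VX)+X_\perp X_\perp^\top VX(X^\top X)^{-1}$, where $X_\perp X_\perp^\top=I_n-X(X^\top X)^{-1}X^\top$. 3. (Bures-Wasserstein metric) $g^{BW(n,k)}_\Sigma(V,V)=\mathrm{tr}\big(S_{\Sigma,V}\Sigma S_{\Sigma,V}+V\Sigma^-V(I_n-UU^\top)\big)$.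
   Context: $\mathrm{Sym}(n)$ is the space of real symmetric $n\times n$ matrices. $\mathrm{Sym}^+(n,k)\subset\mathrm{Sym}(n)$ is the manifold of symmetric positive semi-definite $n\times n$ matrices of rank $k$; its tangent spaces are viewed as subspaces of $\mathrm{Sym}(n)$. $\mathbb{R}^{n\times k}_*$ is the open set of rank-$k$ matrices in $\mathbb{R}^{n\times k}$. $\mathrm{St}(n,k)$ is the set of $n\times k$ matrices with orthonormal columns. For $A\in\mathrm{Sym}(k)$ positive definite and $B\in\mathrm{Sym}(k)$, $\mathcal{S}_A(B)$ is the unique solution $Z$ of $AZ+ZA=B$. $\Sigma^-$ is the Moore-Penrose pseudoinverse of $\Sigma$. For $X\in\mathbb{R}^{n\times k}_*$, $X_\perp\in\mathbb{R}^{n\times(n-k)}$ is a matrix with orthonormal columns ($X_\perp^\top X_\perp=I_{n-k}$) orthogonal to the columns of $X$ ($X^\top X_\perp=0$). The smooth structure on $\mathrm{Sym}^+(n,k)$ is that of the quotient $\mathbb{R}^{n\times k}_*/\mathrm{O}(k)$ for the right action $(X,R)\mapsto XR$, via $\pi:X\in\mathbb{R}^{n\times k}_*\mapsto XX^\top\in\mathrm{Sym}^+(n,k)$, which is a submersion with $d_X\pi(W)=XW^\top+WX^\top$. The Bures-Wasserstein metric $g^{BW(n,k)}$ is the quotient Riemannian metric induced by $\pi$ and the Frobenius metric $\langle M,M\rangle=\mathrm{tr}(M^\top M)$ on $\mathbb{R}^{n\times k}_*$: with the vertical space $\mathcal{V}_X=\ker d_X\pi$ and the horizontal space $\mathcal{H}_X=\mathcal{V}_X^\perp=\{X(X^\top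 X)^{-1}F+X_\perp K: F\in\mathrm{Sym}(k),K\in\mathbb{R}^{(n-k)\times k}\}$, the horizontal lift $V^\#_X$ of $V\in T_\Sigma\mathrm{Sym}^+(n,k)$ at $X$ (where $XX^\top=\Sigma$) is the unique $W\in\mathcal{H}_X$ with $d_X\pi(W)=V$, and $g^{BW(n,k)}_\Sigma(V,V)=\mathrm{tr}\big((V^\#_X)^\top V^\#_X\big)$. *)

theory Defs
  imports
    Complex_Main
    "Jordan_Normal_Form.DL_Rank"
    "Jordan_Normal_Form.Gauss_Jordan_Elimination"
begin

text \<open>Matrices with explicit carriers are used because \<open>n - k\<close>, the number of columns of
  \<open>X\<^sub>\<bottom>\<close>, may be \<open>0\<close>.\<close>

definition trace :: "real mat \<Rightarrow> real" where
  "trace A = (\<Sum>i<dim_row A. A $$ (i, i))"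

definition frobenius_inner :: "real mat \<Rightarrow> real mat \<Rightarrow> real" where
  "frobenius_inner A B = trace (A\<^sup>T * B)"

text \<open>\<open>mat_inverse\<close> returns \<open>None\<close> on singular matrices, where \<open>inverse_mat\<close> is unspecified.\<close>

definition inverse_mat :: "real mat \<Rightarrow> real mat" where
  "inverse_mat A = the (mat_inverse A)"

definition Sym :: "nat \<Rightarrow> real mat set" where
  "Sym n = {A \<in> carrier_mat n n. A\<^sup>T = A}"

definition Sym_plus :: "nat \<Rightarrow> nat \<Rightarrow> real mat set" where
  "Sym_plus n k = {A \<in> Sym n.
     (\<forall>v \<in> carrier_vec n. 0 \<le> v \<bullet> (A *\<^sub>v v)) \<and> vec_space.rank n A = k}"

definition full_rank_mat :: "nat \<Rightarrow> nat \<Rightarrow> real mat set" where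
  "full_rank_mat n k = {X \<in> carrier_mat n k. vec_space.rank n X = k}"

definition Stiefel :: "nat \<Rightarrow> nat \<Rightarrow> real mat set" where
  "Stiefel n k = {U \<in> carrier_mat n k. U\<^sup>T * U = 1\<^sub>m k}"

definition is_orth_complement :: "nat \<Rightarrow> nat \<Rightarrow> real mat \<Rightarrow> real mat \<Rightarrow> bool" where
  "is_orth_complement n k X Xp \<longleftrightarrow> Xp \<in> Stiefel n (n - k) \<and> X\<^sup>T * Xp = 0\<^sub>m k (n - k)"

definition sylvester :: "real mat \<Rightarrow> real mat \<Rightarrow> real mat" where
  "sylvester A B = (THE Z. Z \<in> carrier_mat (dim_row A) (dim_row A) \<and> A * Z + Z * A = B)"

definition moore_penrose :: "real mat \<Rightarrow> real mat" where
  "moore_penrose A = (THE P. P \<in> carrier_mat (dim_col A) (dim_row A) \<and>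
     A * P * A = A \<and> P * A * P = P \<and> (A * P)\<^sup>T = A * P \<and> (P * A)\<^sup>T = P * A)"

definition proj :: "real mat \<Rightarrow> real mat" where
  "proj X = X * X\<^sup>T"

definition d_proj :: "real mat \<Rightarrow> real mat \<Rightarrow> real mat" where
  "d_proj X W = X * W\<^sup>T + W * X\<^sup>T"

lemma d_proj_is_derivative:
  assumes X: "X \<in> carrier_mat n k" and W: "W \<in> carrier_mat n k" and i: "i < n" and j: "j < n"
  shows "((\<lambda>t. proj (X + t \<cdot>\<^sub>m W) $$ (i, j)) has_real_derivative d_proj X W $$ (i, j)) (at 0)"
proof -
  have p: "proj (X + t \<cdot>\<^sub>m W) $$ (i, j) =
      (\<Sum>l<k. (X $$ (i, l) + t * W $$ (i, l)) * (X $$ (j, l) + t * W $$ (j, l)))" for t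
    using assms by (auto simp: proj_def scalar_prod_def lessThan_atLeast0 intro!: sum.cong)
  have d: "d_proj X W $$ (i, j) =
      (\<Sum>l<k. X $$ (i, l) * W $$ (j, l) + W $$ (i, l) * X $$ (j, l))"
    using assms
    by (auto simp: d_proj_def scalar_prod_def lessThan_atLeast0 sum.distrib intro!: sum.cong)
  show ?thesis
    unfolding p d by (auto intro!: derivative_eq_intros sum.cong simp: algebra_simps)
qed

text \<open>The function \<open>f\<close> is \<open>C\<^sup>\<infinity>\<close> on the open set \<open>I\<close>; \<open>D m\<close> is its \<open>m\<close>-th derivative.\<close>

definition smooth_real_on :: "real set \<Rightarrow> (real \<Rightarrow> real) \<Rightarrow> bool" where
  "smooth_real_on I f \<longleftrightarrow> (\<exists>D :: nat \<Rightarrow> real \<Rightarrow> real. D 0 = f \<and>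
     (\<forall>m. \<forall>t \<in> I. (D m has_real_derivative D (Suc m) t) (at t)))"

definition smooth_curve_full_rank ::
  "nat \<Rightarrow> nat \<Rightarrow> real set \<Rightarrow> (real \<Rightarrow> real mat) \<Rightarrow> bool" where
  "smooth_curve_full_rank n k I c \<longleftrightarrow> (\<forall>t \<in> I. c t \<in> full_rank_mat n k) \<and>
     (\<forall>i<n. \<forall>j<k. smooth_real_on I (\<lambda>t. c t $$ (i, j)))"

text \<open>The smooth structure on \<open>Sym_plus n k\<close> is the quotient one, for which \<open>proj\<close> is a
  submersion: a curve is smooth iff it lifts locally to smooth curves of full-rank matrices.\<close>

definition smooth_curve_Sym_plus ::
  "nat \<Rightarrow> nat \<Rightarrow> real set \<Rightarrow> (real \<Rightarrow> real mat) \<Rightarrow> bool" where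
  "smooth_curve_Sym_plus n k I \<gamma> \<longleftrightarrow> (\<forall>t \<in> I. \<gamma> t \<in> Sym_plus n k) \<and>
     (\<forall>s \<in> I. \<exists>J c. open J \<and> s \<in> J \<and> J \<subseteq> I \<and> smooth_curve_full_rank n k J c \<and>
        (\<forall>t \<in> J. \<gamma> t = proj (c t)))"

text \<open>Tangent vectors are the velocities of smooth curves, computed in \<open>Sym n\<close>.\<close>

definition tangent_space :: "nat \<Rightarrow> nat \<Rightarrow> real mat \<Rightarrow> real mat set" where
  "tangent_space n k \<Sigma> = {V \<in> carrier_mat n n. \<exists>\<gamma> \<epsilon>. 0 < \<epsilon> \<and>
     smooth_curve_Sym_plus n k {-\<epsilon><..<\<epsilon>} \<gamma> \<and> \<gamma> 0 = \<Sigma> \<and>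
     (\<forall>i<n. \<forall>j<n. ((\<lambda>t. \<gamma> t $$ (i, j)) has_real_derivative V $$ (i, j)) (at 0))}"

definition vertical_space :: "nat \<Rightarrow> nat \<Rightarrow> real mat \<Rightarrow> real mat set" where
  "vertical_space n k X = {W \<in> carrier_mat n k. d_proj X W = 0\<^sub>m n n}"

definition horizontal_space :: "nat \<Rightarrow> nat \<Rightarrow> real mat \<Rightarrow> real mat set" where
  "horizontal_space n k X =
     {W \<in> carrier_mat n k. \<forall>Z \<in> vertical_space n k X. frobenius_inner Z W = 0}"

definition horizontal_lift :: "nat \<Rightarrow> nat \<Rightarrow> real mat \<Rightarrow> real mat \<Rightarrow> real mat" where
  "horizontal_lift n k X V = (THE W. W \<in> horizontal_space n k X \<and> d_proj X W = V)"

text \<open>The value must not depend on the point \<open>X\<close> of the fibre over \<open>\<Sigma>\<close>.\<close>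

definition BW_metric :: "nat \<Rightarrow> nat \<Rightarrow> real mat \<Rightarrow> real mat \<Rightarrow> real mat \<Rightarrow> real" where
  "BW_metric n k \<Sigma> V W = (THE g. \<forall>X \<in> full_rank_mat n k. proj X = \<Sigma> \<longrightarrow>
     g = frobenius_inner (horizontal_lift n k X V) (horizontal_lift n k X W))"

definition is_decomposition :: "nat \<Rightarrow> nat \<Rightarrow> real mat \<Rightarrow> real mat \<Rightarrow> real mat \<Rightarrow> bool" where
  "is_decomposition n k \<Sigma> U D \<longleftrightarrow> U \<in> Stiefel n k \<and> D \<in> carrier_mat k k \<and> diagonal_mat D \<and>
     (\<forall>i<k. 0 < D $$ (i, i)) \<and> \<Sigma> = U * D * U\<^sup>T"

definition S_mat :: "real mat \<Rightarrow> real mat \<Rightarrow> real mat \<Rightarrow> real mat" where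
  "S_mat U D V = U * sylvester D (U\<^sup>T * V * U) * U\<^sup>T"

end

theory Submission
  imports Defs
begin

text \<open>
  Let \<open>P = U U\<^sup>T\<close> be the orthogonal projector onto the range of \<open>\<Sigma>\<close> and \<open>Q = 1 - P\<close>.  Every \<open>X\<close> with
  \<open>X X\<^sup>T = \<Sigma>\<close> has that same range, so with \<open>G = X\<^sup>T X\<close> also \<open>P = X G\<^sup>-\<^sup>1 X\<^sup>T\<close> and \<open>Q = Xp Xp\<^sup>T\<close>
  (\<open>orth_projectors_complementary\<close>, \<open>decomposition_range\<close>).  In particular \<open>P\<close> and \<open>Q\<close> do not depend on
  the decomposition.

  The matrix \<open>S = U Z U\<^sup>T\<close>, where \<open>D Z + Z D = U\<^sup>T V U\<close>, is the only matrix with \<open>P S P = S\<close> and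
  \<open>\<Sigma> S + S \<Sigma> = P V P\<close> (\<open>S_mat_props\<close>, \<open>S_mat_eqI\<close>): in the coordinates of \<open>U\<close> these conditions become the
  diagonal Sylvester equation, whose entries \<open>(d\<^sub>i + d\<^sub>j) Z\<^sub>i\<^sub>j\<close> determine \<open>Z\<close>.  This characterisation
  mentions \<open>\<Sigma>\<close> and \<open>P\<close> only, so \<open>S\<close> does not depend on the decomposition.  Read in the coordinates of
  \<open>X\<close>, it says that \<open>X\<^sup>T S X\<close> is the unique solution of the Sylvester equation for \<open>G\<close> with right-hand side
  \<open>X\<^sup>T V X\<close> (\<open>sylvester_Gram\<close>).  Since \<open>X G\<^sup>-\<^sup>1 X\<^sup>T S X = P S X = S X\<close>, the claimed horizontal lift is
  \<open>W = S X + Q V X G\<^sup>-\<^sup>1\<close>.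

  A vector \<open>V\<close> is tangent iff it is symmetric with \<open>Q V Q = 0\<close> (\<open>tangent_space_eq\<close>).  The velocity of a curve
  \<open>Y(t) Y(t)\<^sup>T\<close> is \<open>d_proj Y W\<close>, which is symmetric, and \<open>Xp\<^sup>T (d_proj Y W) Xp = 0\<close> because
  \<open>Y\<^sup>T Xp = 0\<close>.  Conversely such a \<open>V\<close> equals \<open>P V P + P V Q + Q V P\<close> and therefore has the form \<open>d_proj X W\<close>; it is the velocity at \<open>0\<close> of the
  image of the line \<open>X + t W\<close>, which stays in the full-rank matrices for small \<open>t\<close>.

  The matrix \<open>W\<close> above projects to \<open>V\<close> by this block decomposition (\<open>d_proj_add_cross_term\<close>).  It is
  horizontal because a vertical \<open>Z\<close> satisfies \<open>Q Z = 0\<close> and makes \<open>X Z\<^sup>T\<close> skew-symmetric, hence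
  trace-orthogonal to the symmetric matrix \<open>S\<close> (\<open>horizontalI\<close>).  As \<open>S Xp = 0\<close>, the two summands of \<open>W\<close> are
  orthogonal, and cyclicity of the trace turns their squared norms into \<open>tr (S \<Sigma> S)\<close> and
  \<open>tr (V \<Sigma>\<^sup>- V Q)\<close> with \<open>\<Sigma>\<^sup>- = X G\<^sup>-\<^sup>2 X\<^sup>T\<close> (\<open>horizontal_lift_norm\<close>).  The result mentions \<open>\<Sigma>\<close> and \<open>V\<close> but not
  \<open>X\<close>, so the metric is well defined.
\<close>

section \<open>Matrix algebra with side conditions on dimensions\<close>

text \<open>The carrier forms of these laws leave the intermediate dimensions as unknowns. Stated with
  equations between dimensions, their side conditions are decided by rewriting, and together the laws
  normalise matrix expressions to sums of right-nested products.\<close>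
declare assoc_mult_mat [simp del] left_mult_one_mat [simp del] right_mult_one_mat [simp del]

lemma mult_assoc_dim:
  "dim_col A = dim_row B \<Longrightarrow> dim_col B = dim_row C \<Longrightarrow> A * B * C = A * (B * C)"
  for A B C :: "real mat"
  by (rule assoc_mult_mat[of _ "dim_row A" "dim_row B" _ "dim_row C" _ "dim_col C"]) auto

lemma mult_add_dim:
  "dim_col A = dim_row B \<Longrightarrow> dim_row C = dim_row B \<Longrightarrow> dim_col C = dim_col B \<Longrightarrow>
    A * (B + C) = A * B + A * C" for A B C :: "real mat"
  by (rule mult_add_distrib_mat[of _ "dim_row A" "dim_row B" _ "dim_col B"]) auto

lemma add_mult_dim:
  "dim_col A = dim_row C \<Longrightarrow> dim_row B = dim_row A \<Longrightarrow> dim_col B = dim_col A \<Longrightarrow>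
    (A + B) * C = A * C + B * C" for A B C :: "real mat"
  by (rule add_mult_distrib_mat[of _ "dim_row A" "dim_col A" _ _ "dim_col C"]) auto

lemma mult_minus_dim:
  "dim_col A = dim_row B \<Longrightarrow> dim_row C = dim_row B \<Longrightarrow> dim_col C = dim_col B \<Longrightarrow>
    A * (B - C) = A * B - A * C" for A B C :: "real mat"
  by (rule mult_minus_distrib_mat[of _ "dim_row A" "dim_row B" _ "dim_col B"]) auto

lemma minus_mult_dim:
  "dim_col A = dim_row C \<Longrightarrow> dim_row B = dim_row A \<Longrightarrow> dim_col B = dim_col A \<Longrightarrow>
    (A - B) * C = A * C - B * C" for A B C :: "real mat"
  by (rule minus_mult_distrib_mat[of _ "dim_row A" "dim_col A" _ _ "dim_col C"]) auto

lemma transpose_mult_dim: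
  "dim_col A = dim_row B \<Longrightarrow> (A * B)\<^sup>T = B\<^sup>T * A\<^sup>T" for A B :: "real mat"
  by (rule transpose_mult[of _ "dim_row A" "dim_row B" _ "dim_col B"]) auto

lemma transpose_add_dim:
  "dim_row B = dim_row A \<Longrightarrow> dim_col B = dim_col A \<Longrightarrow> (A + B)\<^sup>T = A\<^sup>T + B\<^sup>T" for A B :: "real mat"
  by (rule transpose_add[of _ "dim_row A" "dim_col A"]) auto

lemma transpose_minus_dim:
  "dim_row B = dim_row A \<Longrightarrow> dim_col B = dim_col A \<Longrightarrow> (A - B)\<^sup>T = A\<^sup>T - B\<^sup>T" for A B :: "real mat"
  by (rule transpose_minus[of _ "dim_row A" "dim_col A"]) auto

lemma transpose_smult_dim: "(c \<cdot>\<^sub>m A)\<^sup>T = c \<cdot>\<^sub>m A\<^sup>T" for A :: "real mat"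
  by (rule eq_matI) auto

lemma mult_smult_dim:
  "dim_col A = dim_row B \<Longrightarrow> A * (c \<cdot>\<^sub>m B) = c \<cdot>\<^sub>m (A * B)" for A B :: "real mat"
  by (rule mult_smult_distrib[of _ "dim_row A" "dim_row B" _ "dim_col B"]) auto

lemma smult_mult_dim:
  "dim_col A = dim_row B \<Longrightarrow> (c \<cdot>\<^sub>m A) * B = c \<cdot>\<^sub>m (A * B)" for A B :: "real mat"
  by (rule mult_smult_assoc_mat[of _ "dim_row A" "dim_row B" _ "dim_col B"]) auto

lemma one_mult_dim: "dim_row A = m \<Longrightarrow> 1\<^sub>m m * A = A" for A :: "real mat"
  by (rule left_mult_one_mat[of _ _ "dim_col A"]) auto

lemma mult_one_dim: "dim_col A = m \<Longrightarrow> A * 1\<^sub>m m = A" for A :: "real mat"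
  by (rule right_mult_one_mat[of _ "dim_row A"]) auto

lemma zero_mult_dim: "dim_row A = m \<Longrightarrow> 0\<^sub>m l m * A = 0\<^sub>m l (dim_col A)" for A :: "real mat"
  by (rule left_mult_zero_mat) auto

lemma mult_zero_dim: "dim_col A = m \<Longrightarrow> A * 0\<^sub>m m l = 0\<^sub>m (dim_row A) l" for A :: "real mat"
  by (rule right_mult_zero_mat) auto

lemma add_zero_dim: "dim_row A = l \<Longrightarrow> dim_col A = m \<Longrightarrow> A + 0\<^sub>m l m = A"
  "dim_row A = l \<Longrightarrow> dim_col A = m \<Longrightarrow> 0\<^sub>m l m + A = A"
  "dim_row A = l \<Longrightarrow> dim_col A = m \<Longrightarrow> A - 0\<^sub>m l m = A" for A :: "real mat"
  by (auto intro!: eq_matI)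

lemmas mat_algebra = mult_assoc_dim mult_add_dim add_mult_dim mult_minus_dim minus_mult_dim
  transpose_mult_dim transpose_add_dim transpose_minus_dim transpose_smult_dim
  mult_smult_dim smult_mult_dim one_mult_dim mult_one_dim zero_mult_dim mult_zero_dim add_zero_dim

text \<open>In a right-nested product a known value of \<open>A * B\<close> occurs in front of a further factor; this
  form lets rewriting find it there.\<close>
lemma mult_eq_extend:
  "A * B = C \<Longrightarrow> dim_col A = dim_row B \<Longrightarrow> dim_col B = dim_row M \<Longrightarrow> A * (B * M) = C * M"
  for A B C M :: "real mat"
  by (metis mult_assoc_dim)

lemma trace_mult_commute:
  "dim_col A = dim_row B \<Longrightarrow> dim_col B = dim_row A \<Longrightarrow> trace (A * B) = trace (B * A)"
  by (simp add: trace_def scalar_prod_def lessThan_atLeast0 sum.swap[of _ "{0..<dim_row A}"] mult.commute)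

lemma trace_add:
  "dim_row B = dim_row A \<Longrightarrow> dim_col A = dim_row A \<Longrightarrow> dim_col B = dim_row A \<Longrightarrow>
    trace (A + B) = trace A + trace B"
  by (simp add: trace_def sum.distrib)

lemma trace_minus:
  "dim_row B = dim_row A \<Longrightarrow> dim_col A = dim_row A \<Longrightarrow> dim_col B = dim_row A \<Longrightarrow>
    trace (A - B) = trace A - trace B"
  by (simp add: trace_def sum_subtractf)

lemma trace_transpose: "dim_col A = dim_row A \<Longrightarrow> trace (A\<^sup>T) = trace A"
  by (simp add: trace_def)

lemma trace_one [simp]: "trace (1\<^sub>m m) = m" by (simp add: trace_def)

lemma trace_zero [simp]: "trace (0\<^sub>m m m) = 0" by (simp add: trace_def)

lemma frobenius_inner_self_eq_0:
  assumes "frobenius_inner A A = 0" shows "A = 0\<^sub>m (dim_row A) (dim_col A)"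
proof -
  have "(\<Sum>j<dim_col A. \<Sum>i<dim_row A. (A $$ (i,j))\<^sup>2) = 0"
    using assms by (simp add: frobenius_inner_def trace_def scalar_prod_def lessThan_atLeast0 power2_eq_square)
  then have "\<forall>j<dim_col A. \<forall>i<dim_row A. A $$ (i,j) = 0"
    by (simp add: sum_nonneg_eq_0_iff sum_nonneg)
  then show ?thesis by (intro eq_matI) auto
qed

section \<open>Full rank and Gram matrices\<close>

lemma full_rank_if_left_inverse:
  assumes Y: "Y \<in> carrier_mat n k" and L: "L \<in> carrier_mat k n" and LY: "L * Y = 1\<^sub>m k"
  shows "Y \<in> full_rank_mat n k"
proof -
  interpret vec_space "TYPE(real)" n .
  have "distinct (cols Y)"
  proof (subst distinct_conv_nth, intro allI impI)
    fix i j assume ij: "i < length (cols Y)" "j < length (cols Y)" "i \<noteq> j"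
    \<comment> \<open>\<open>L\<close> sends the columns of \<open>Y\<close> to the unit vectors, so they cannot coincide.\<close>
    have c: "L *\<^sub>v col Y l = unit_vec k l" if "l < k" for l
      using col_mult2[OF L Y that] that by (simp add: LY)
    have "unit_vec k i \<noteq> (unit_vec k j :: real vec)"
      using ij Y by (metis carrier_matD(2) cols_length index_unit_vec(1) zero_neq_one)
    then show "cols Y ! i \<noteq> cols Y ! j" using c[of i] c[of j] ij Y by auto
  qed
  moreover have "lin_indpt (set (cols Y))"
  proof
    assume "lin_dep (set (cols Y))"
    then obtain v where v: "v \<in> carrier_vec k" "v \<noteq> 0\<^sub>v k" "Y *\<^sub>v v = 0\<^sub>v n"
      using lin_depE[OF Y _ \<open>distinct (cols Y)\<close>] by auto
    have "v = (L * Y) *\<^sub>v v" using v by (simp add: LY)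
    also have "\<dots> = L *\<^sub>v (Y *\<^sub>v v)" using assoc_mult_mat_vec[OF L Y v(1)] .
    also have "\<dots> = 0\<^sub>v k" using v L by (auto intro!: eq_vecI)
    finally show False using v by simp
  qed
  ultimately show ?thesis using lin_indpt_full_rank[OF Y] Y by (simp add: full_rank_mat_def)
qed

text \<open>The rank is at most the number of distinct columns.\<close>
lemma full_rank_distinct_cols:
  assumes X: "X \<in> full_rank_mat n k" shows "distinct (cols X)"
proof -
  interpret vec_space "TYPE(real)" n .
  have C: "X \<in> carrier_mat n k" and r: "rank X = k" using X by (auto simp: full_rank_mat_def)
  obtain B where B: "maximal B (\<lambda>T. T \<subseteq> set (cols X) \<and> lin_indpt T)"
    using maximal_exists[of "\<lambda>T. T \<subseteq> set (cols X) \<and> lin_indpt T" "card (set (cols X))" "{}"]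
    by (meson List.finite_set card_mono empty_iff empty_subsetI finite_lin_indpt2 rev_finite_subset)
  have "k \<le> card (set (cols X))"
    using rank_card_indpt[OF C B] r B by (simp add: card_mono maximal_def)
  then show ?thesis using C by (metis card_distinct card_length cols_length carrier_matD(2) le_antisym)
qed

lemma full_rank_kernel:
  assumes X: "X \<in> full_rank_mat n k" and v: "v \<in> carrier_vec k" "X *\<^sub>v v = 0\<^sub>v n"
  shows "v = 0\<^sub>v k"
proof -
  interpret vec_space "TYPE(real)" n .
  have C: "X \<in> carrier_mat n k" and r: "rank X = k" using X by (auto simp: full_rank_mat_def)
  have "lin_indpt (set (cols X))" using full_rank_lin_indpt[OF C r full_rank_distinct_cols[OF X]] .
  then show ?thesis using lin_depI[OF C v(1) _ v(2) full_rank_distinct_cols[OF X]] by auto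
qed

lemma inverse_mat_nonsingular:
  assumes A: "A \<in> carrier_mat m m" and d: "det A \<noteq> 0"
  shows "inverse_mat A \<in> carrier_mat m m" "A * inverse_mat A = 1\<^sub>m m" "inverse_mat A * A = 1\<^sub>m m"
proof -
  have "A \<in> Units (ring_mat TYPE(real) m ())" using det_non_zero_imp_unit[OF A d] .
  then have "mat_inverse A \<noteq> None" using mat_inverse(1)[OF A, where b = "()"] by metis
  then obtain B where "mat_inverse A = Some B" by auto
  then show "inverse_mat A \<in> carrier_mat m m" "A * inverse_mat A = 1\<^sub>m m" "inverse_mat A * A = 1\<^sub>m m"
    using mat_inverse(2)[OF A] by (auto simp: inverse_mat_def)
qed

lemma det_Gram_neq_0:
  assumes X: "X \<in> full_rank_mat n k" shows "det (X\<^sup>T * X) \<noteq> 0"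
proof
  assume "det (X\<^sup>T * X) = 0"
  have C: "X \<in> carrier_mat n k" using X by (auto simp: full_rank_mat_def)
  then have "X\<^sup>T * X \<in> carrier_mat k k" by auto
  from det_0_iff_vec_prod_zero[OF this] \<open>det (X\<^sup>T * X) = 0\<close>
  obtain v where v: "v \<in> carrier_vec k" "v \<noteq> 0\<^sub>v k" "(X\<^sup>T * X) *\<^sub>v v = 0\<^sub>v k" by auto
  \<comment> \<open>A kernel vector of the Gram matrix satisfies \<open>|X v|\<^sup>2 = v\<^sup>T X\<^sup>T X v = 0\<close>.\<close>
  have "(X *\<^sub>v v) \<bullet> (X *\<^sub>v v) = v \<bullet> ((X\<^sup>T * X) *\<^sub>v v)"
    using C v transpose_vec_mult_scalar[OF C v(1), of "X *\<^sub>v v"] by simp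
  also have "\<dots> = 0" using v by simp
  finally have "(\<Sum>i<n. ((X *\<^sub>v v) $ i)\<^sup>2) = 0"
    using C by (simp add: scalar_prod_def lessThan_atLeast0 power2_eq_square)
  then have "X *\<^sub>v v = 0\<^sub>v n" using C by (intro eq_vecI) (auto simp: sum_nonneg_eq_0_iff)
  then show False using full_rank_kernel[OF X v(1)] v by auto
qed

text \<open>Each of the two matrices has its columns in the column space of the other.\<close>
lemma rank_eqI_col_factors:
  fixes A B :: "real mat"
  assumes A: "A \<in> carrier_mat n a" and B: "B \<in> carrier_mat n b"
    and M: "M \<in> carrier_mat b a" "A = B * M" and N: "N \<in> carrier_mat a b" "B = A * N"
  shows "vec_space.rank n A = vec_space.rank n B"
proof -
  interpret vec_space "TYPE(real)" n .
  have sub: "col_space (C * R) \<subseteq> col_space C"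
    if C: "C \<in> carrier_mat n c" and R: "R \<in> carrier_mat c r" for C R :: "real mat" and c r
  proof
    fix y assume "y \<in> col_space (C * R)"
    then obtain x where x: "x \<in> carrier_vec r" "y = (C * R) *\<^sub>v x"
      using col_space_eq[of "C * R" r] C R by auto
    then have "y = C *\<^sub>v (R *\<^sub>v x)" using assoc_mult_mat_vec[OF C R] by simp
    then show "y \<in> col_space C" using col_space_eq[OF C] C R x(1) by auto
  qed
  have "col_space A = col_space B"
    using sub[OF B M(1), folded M(2)] sub[OF A N(1), folded N(2)] by (rule equalityI)
  then show ?thesis by (simp add: rank_def col_space_def)
qed

text \<open>The rank is the one of \<open>Y\<close>, since \<open>Y = (Y Y\<^sup>T) (Y (Y\<^sup>T Y)\<^sup>-\<^sup>1)\<close> has the same column space as \<open>Y Y\<^sup>T\<close>.\<close>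
lemma proj_in_Sym_plus:
  assumes Y: "Y \<in> full_rank_mat n k" shows "proj Y \<in> Sym_plus n k"
proof -
  have C: "Y \<in> carrier_mat n k" and r: "vec_space.rank n Y = k" using Y by (auto simp: full_rank_mat_def)
  have "Y\<^sup>T * Y \<in> carrier_mat k k" using C by auto
  note I = inverse_mat_nonsingular[OF this det_Gram_neq_0[OF Y]]
  have [simp]: "dim_row Y = n" "dim_col Y = k" "dim_row (inverse_mat (Y\<^sup>T * Y)) = k" using C I by auto
  have "Y * Y\<^sup>T * (Y * inverse_mat (Y\<^sup>T * Y)) = Y * (Y\<^sup>T * Y * inverse_mat (Y\<^sup>T * Y))"
    by (simp add: mult_assoc_dim)
  then have "Y = Y * Y\<^sup>T * (Y * inverse_mat (Y\<^sup>T * Y))" by (simp add: I(2) mult_one_dim)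
  then have "vec_space.rank n (Y * Y\<^sup>T) = k"
    using rank_eqI_col_factors[of "Y * Y\<^sup>T" n n Y k "Y\<^sup>T" "Y * inverse_mat (Y\<^sup>T * Y)"] C I(1) r by auto
  moreover have "0 \<le> v \<bullet> (Y * Y\<^sup>T *\<^sub>v v)" if v: "v \<in> carrier_vec n" for v
  proof -
    have "v \<bullet> (Y * Y\<^sup>T *\<^sub>v v) = (Y\<^sup>T *\<^sub>v v) \<bullet> (Y\<^sup>T *\<^sub>v v)"
      using transpose_vec_mult_scalar[of "Y\<^sup>T" k n v "Y\<^sup>T *\<^sub>v v"] C v
        comm_scalar_prod[of v n "Y *\<^sub>v (Y\<^sup>T *\<^sub>v v)"] by simp
    then show ?thesis by (simp add: scalar_prod_def sum_nonneg)
  qed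
  ultimately show ?thesis using C by (auto simp: Sym_plus_def Sym_def proj_def transpose_mult_dim)
qed

text \<open>The difference of the two sides is an orthogonal projector of trace \<open>n - k - m = 0\<close>, hence zero. The
  matrix \<open>H\<close> is the inverse of the Gram matrix of \<open>X\<close>; the case \<open>H = 1\<close> covers orthonormal columns.\<close>
lemma orth_projectors_complementary:
  fixes X Xp H :: "real mat"
  assumes dims: "X \<in> carrier_mat n k" "Xp \<in> carrier_mat n m" "H \<in> carrier_mat k k" and n: "n = k + m"
    and H: "H\<^sup>T = H" "X\<^sup>T * X * H = 1\<^sub>m k"
    and Xp: "Xp\<^sup>T * Xp = 1\<^sub>m m" "X\<^sup>T * Xp = 0\<^sub>m k m"
  shows "Xp * Xp\<^sup>T = 1\<^sub>m n - X * H * X\<^sup>T"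
proof -
  have [simp]: "dim_row X = n" "dim_col X = k" "dim_row Xp = n" "dim_col Xp = m"
    "dim_row H = k" "dim_col H = k" using dims by auto
  define E where "E = 1\<^sub>m n - X * H * X\<^sup>T - Xp * Xp\<^sup>T"
  have [simp]: "dim_row E = n" "dim_col E = n" by (simp_all add: E_def)
  have XH: "X\<^sup>T * (X * H) = 1\<^sub>m k" using H(2) by (simp add: mat_algebra)
  have XpX: "Xp\<^sup>T * X = 0\<^sub>m m k" using arg_cong[OF Xp(2), of transpose_mat] by (simp add: transpose_mult_dim)
  have XH': "X\<^sup>T * (X * (H * M)) = M" if "dim_row M = k" for M
    using mult_eq_extend[OF XH, of M] that by (simp add: mat_algebra)
  note ext = XH XH' Xp XpX mult_eq_extend[OF Xp(1)] mult_eq_extend[OF Xp(2)] mult_eq_extend[OF XpX]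
  \<comment> \<open>\<open>E\<close> is an orthogonal projector, so its squared Frobenius norm is its trace.\<close>
  have EE: "E\<^sup>T * E = E"
    by (simp add: E_def mat_algebra ext H(1)) (auto intro!: eq_matI)
  have "trace (X * H * X\<^sup>T) = real k"
    using trace_mult_commute[of "X * H" "X\<^sup>T"] by (simp add: XH)
  moreover have "trace (Xp * Xp\<^sup>T) = real m"
    using trace_mult_commute[of Xp "Xp\<^sup>T"] by (simp add: Xp)
  ultimately have "trace E = 0" by (simp add: E_def trace_minus n)
  then have "E = 0\<^sub>m n n" using frobenius_inner_self_eq_0[of E] EE by (simp add: frobenius_inner_def)
  then have "E $$ (i, j) = 0" if "i < n" "j < n" for i j using that by simp
  then show ?thesis by (intro eq_matI) (auto simp: E_def)
qed

section \<open>Sylvester equations and the pseudoinverse\<close>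

lemma diagonal_mult_index:
  fixes D Z :: "real mat"
  assumes "D \<in> carrier_mat k k" "diagonal_mat D" "Z \<in> carrier_mat k m" "i < k" "j < m"
  shows "(D * Z) $$ (i, j) = D $$ (i, i) * Z $$ (i, j)"
proof -
  have "(D * Z) $$ (i, j) = (\<Sum>l<k. if l = i then D $$ (i, i) * Z $$ (i, j) else 0)"
    using assms
    by (simp add: scalar_prod_def lessThan_atLeast0 diagonal_mat_def del: sum.delta sum.delta')
      (rule sum.cong, auto)
  then show ?thesis using assms by simp
qed

lemma diagonal_transpose: "D \<in> carrier_mat k k \<Longrightarrow> diagonal_mat D \<Longrightarrow> D\<^sup>T = D"
  by (intro eq_matI) (auto simp: diagonal_mat_def, metis)

lemma diagonal_anticommutator:
  fixes D Z :: "real mat"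
  assumes D: "D \<in> carrier_mat k k" "diagonal_mat D" and Z: "Z \<in> carrier_mat k k" and ij: "i < k" "j < k"
  shows "(D * Z + Z * D) $$ (i, j) = (D $$ (i, i) + D $$ (j, j)) * Z $$ (i, j)"
proof -
  have "(D * Z\<^sup>T)\<^sup>T = Z * D"
    using D Z by (simp add: transpose_mult_dim diagonal_transpose[OF D])
  then have "(Z * D) $$ (i, j) = (D * Z\<^sup>T) $$ (j, i)"
    using D Z ij by (metis carrier_matD index_mult_mat(2,3) index_transpose_mat)
  then show ?thesis
    using assms diagonal_mult_index[OF D Z ij] diagonal_mult_index[OF D, of "Z\<^sup>T" k j i]
    by (simp add: distrib_right del: index_mult_mat(1))
qed

lemma sylvester_diagonal_unique:
  fixes D Z Z' :: "real mat"
  assumes D: "D \<in> carrier_mat k k" "diagonal_mat D" "\<forall>i<k. 0 < D $$ (i, i)"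
    and Z: "Z \<in> carrier_mat k k" "Z' \<in> carrier_mat k k" and eq: "D * Z + Z * D = D * Z' + Z' * D"
  shows "Z = Z'"
proof (intro eq_matI)
  fix i j assume "i < dim_row Z'" "j < dim_col Z'"
  then have ij: "i < k" "j < k" using Z by auto
  then have "(D $$ (i, i) + D $$ (j, j)) * Z $$ (i, j) = (D $$ (i, i) + D $$ (j, j)) * Z' $$ (i, j)"
    using diagonal_anticommutator[OF D(1,2) Z(1) ij] diagonal_anticommutator[OF D(1,2) Z(2) ij] eq by metis
  moreover have "0 < D $$ (i, i) + D $$ (j, j)" using D(3) ij by (simp add: add_pos_pos)
  ultimately show "Z $$ (i, j) = Z' $$ (i, j)" by (metis mult_cancel_left less_irrefl)
qed (use Z in auto)

lemma sylvester_diagonal: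
  assumes D: "D \<in> carrier_mat k k" "diagonal_mat D" "\<forall>i<k. 0 < D $$ (i, i)" and B: "B \<in> carrier_mat k k"
  shows "sylvester D B \<in> carrier_mat k k \<and> D * sylvester D B + sylvester D B * D = B"
proof -
  define Z where "Z = mat k k (\<lambda>(i, j). B $$ (i, j) / (D $$ (i, i) + D $$ (j, j)))"
  have Z: "Z \<in> carrier_mat k k" by (simp add: Z_def)
  have "D * Z + Z * D = B"
  proof (intro eq_matI)
    fix i j assume "i < dim_row B" "j < dim_col B"
    then have ij: "i < k" "j < k" using B by auto
    moreover have "0 < D $$ (i, i) + D $$ (j, j)" using D(3) ij by (simp add: add_pos_pos)
    ultimately show "(D * Z + Z * D) $$ (i, j) = B $$ (i, j)"
      unfolding diagonal_anticommutator[OF D(1,2) Z ij] by (simp add: Z_def)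
  qed (use B D Z in auto)
  then have "\<exists>!Z. Z \<in> carrier_mat (dim_row D) (dim_row D) \<and> D * Z + Z * D = B"
    using Z D(1) sylvester_diagonal_unique[OF D] by auto
  from theI'[OF this] show ?thesis using D(1) unfolding sylvester_def by auto
qed

lemma moore_penroseI:
  assumes P: "P \<in> carrier_mat (dim_col A) (dim_row A)"
    and eqs: "A * P * A = A" "P * A * P = P" "(A * P)\<^sup>T = A * P" "(P * A)\<^sup>T = P * A"
  shows "moore_penrose A = P"
  unfolding moore_penrose_def
proof (rule the_equality)
  fix R assume R: "R \<in> carrier_mat (dim_col A) (dim_row A) \<and>
     A * R * A = A \<and> R * A * R = R \<and> (A * R)\<^sup>T = A * R \<and> (R * A)\<^sup>T = R * A"
  have [simp]: "dim_row P = dim_col A" "dim_col P = dim_row A" "dim_row R = dim_col A" "dim_col R = dim_row A"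
    using P R by auto
  \<comment> \<open>For another pseudoinverse \<open>R\<close>, the symmetric products give \<open>A R = A P A R = ((A R A) P)\<^sup>T = A P\<close>,
    and \<open>R A = P A\<close> likewise.\<close>
  have "A * R = (A * P * A) * R" using eqs by simp
  also have "\<dots> = (A * P) * (A * R)" by (simp add: mult_assoc_dim)
  also have "\<dots> = (A * P)\<^sup>T * (A * R)\<^sup>T" using eqs R by simp
  also have "\<dots> = ((A * R * A) * P)\<^sup>T" by (simp add: mat_algebra)
  also have "\<dots> = A * P" using eqs R by simp
  finally have AR: "A * R = A * P" .
  have "R * A = R * (A * P * A)" using eqs by simp
  also have "\<dots> = (R * A) * (P * A)" by (simp add: mult_assoc_dim)
  also have "\<dots> = (R * A)\<^sup>T * (P * A)\<^sup>T" using eqs R by simp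
  also have "\<dots> = (P * (A * R * A))\<^sup>T" by (simp add: mat_algebra)
  also have "\<dots> = P * A" using eqs R by simp
  finally have RA: "R * A = P * A" .
  have "R = R * A * R" using R by simp
  also have "\<dots> = P * (A * R)" by (simp add: RA mult_assoc_dim)
  also have "\<dots> = P" using eqs(2) by (simp add: AR mult_assoc_dim)
  finally show "R = P" .
qed (use assms in auto)

lemma decompositionD:
  assumes "is_decomposition n k \<Sigma> U D"
  shows "D \<in> carrier_mat k k" "diagonal_mat D" "\<forall>i<k. 0 < D $$ (i, i)"
    "U \<in> carrier_mat n k" "U\<^sup>T * U = 1\<^sub>m k" "\<Sigma> = U * D * U\<^sup>T"
  using assms by (auto simp: is_decomposition_def Stiefel_def)

text \<open>This characterises \<open>S_mat\<close> by \<open>\<Sigma>\<close> and the projector \<open>U U\<^sup>T\<close> alone, whatever \<open>U\<close> and \<open>D\<close> are. It is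
  the reason for the independence of the decomposition, and it also relates \<open>S_mat\<close> to the Sylvester equation
  of a Gram matrix.\<close>
lemma S_mat_eqI:
  assumes dec: "is_decomposition n k \<Sigma> U D" and V: "V \<in> carrier_mat n n" and T: "T \<in> carrier_mat n n"
    and supp: "U * U\<^sup>T * T * (U * U\<^sup>T) = T"
    and eq: "\<Sigma> * T + T * \<Sigma> = U * U\<^sup>T * V * (U * U\<^sup>T)"
  shows "S_mat U D V = T"
proof -
  note d = decompositionD[OF dec]
  have [simp]: "dim_row U = n" "dim_col U = k" "dim_row D = k" "dim_col D = k"
    "dim_row V = n" "dim_col V = n" "dim_row T = n" "dim_col T = n" using d(1,4) V T by auto
  have UM: "U\<^sup>T * (U * M) = M" if "dim_row M = k" for M
    using mult_eq_extend[OF d(5), of M] that by (simp add: mat_algebra)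
  let ?Z = "U\<^sup>T * T * U"
  have "U\<^sup>T * V * U \<in> carrier_mat k k" and Z: "?Z \<in> carrier_mat k k"
    by (rule carrier_matI, simp, simp)+
  note sylv = sylvester_diagonal[OF d(1-3) this(1)]
  \<comment> \<open>Compressing \<open>\<Sigma> T + T \<Sigma> = P V P\<close> to the coordinates of \<open>U\<close> gives the Sylvester equation for \<open>D\<close>.\<close>
  have "D * ?Z + ?Z * D = U\<^sup>T * (\<Sigma> * T + T * \<Sigma>) * U"
    unfolding d(6) by (simp add: mat_algebra d(5) UM)
  also have "\<dots> = U\<^sup>T * V * U"
    unfolding eq by (simp add: mat_algebra d(5) UM)
  finally have "sylvester D (U\<^sup>T * V * U) = ?Z"
    using sylvester_diagonal_unique[OF d(1-3) _ Z] sylv by metis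
  then have "S_mat U D V = U * U\<^sup>T * T * (U * U\<^sup>T)" by (simp add: S_mat_def mat_algebra)
  then show ?thesis using supp by simp
qed

lemma S_mat_props:
  assumes dec: "is_decomposition n k \<Sigma> U D" and V: "V \<in> carrier_mat n n"
  shows "S_mat U D V \<in> carrier_mat n n" "U * U\<^sup>T * S_mat U D V = S_mat U D V"
    "S_mat U D V * (U * U\<^sup>T) = S_mat U D V"
    "\<Sigma> * S_mat U D V + S_mat U D V * \<Sigma> = U * U\<^sup>T * V * (U * U\<^sup>T)"
    "V\<^sup>T = V \<Longrightarrow> (S_mat U D V)\<^sup>T = S_mat U D V"
proof -
  note d = decompositionD[OF dec]
  have [simp]: "dim_row U = n" "dim_col U = k" "dim_row D = k" "dim_col D = k"
    "dim_row V = n" "dim_col V = n" using d(1,4) V by auto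
  have UM: "U\<^sup>T * (U * M) = M" if "dim_row M = k" for M
    using mult_eq_extend[OF d(5), of M] that by (simp add: mat_algebra)
  define Z where "Z = sylvester D (U\<^sup>T * V * U)"
  have "U\<^sup>T * V * U \<in> carrier_mat k k" by (rule carrier_matI) simp_all
  from sylvester_diagonal[OF d(1-3) this]
  have Z: "Z \<in> carrier_mat k k" "D * Z + Z * D = U\<^sup>T * V * U" unfolding Z_def by blast+
  have [simp]: "dim_row Z = k" "dim_col Z = k" using Z(1) by auto
  have S: "S_mat U D V = U * (Z * U\<^sup>T)" unfolding S_mat_def Z_def[symmetric] by (simp add: mult_assoc_dim)
  show C: "S_mat U D V \<in> carrier_mat n n" unfolding S by (rule carrier_matI) simp_all
  show P: "U * U\<^sup>T * S_mat U D V = S_mat U D V" "S_mat U D V * (U * U\<^sup>T) = S_mat U D V"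
    unfolding S by (simp_all add: mat_algebra d(5) UM)
  have "\<Sigma> * S_mat U D V + S_mat U D V * \<Sigma> = U * (D * Z + Z * D) * U\<^sup>T"
    unfolding S d(6) by (simp add: mat_algebra d(5) UM)
  then show E: "\<Sigma> * S_mat U D V + S_mat U D V * \<Sigma> = U * U\<^sup>T * V * (U * U\<^sup>T)"
    unfolding Z(2) by (simp add: mult_assoc_dim)
  \<comment> \<open>The transpose solves the same two equations, hence is equal by uniqueness.\<close>
  assume sym: "V\<^sup>T = V"
  have \<Sigma>: "\<Sigma>\<^sup>T = \<Sigma>" "dim_row \<Sigma> = n" "dim_col \<Sigma> = n"
    unfolding d(6) by (simp_all add: mat_algebra diagonal_transpose[OF d(1,2)])
  let ?S = "S_mat U D V"
  have [simp]: "dim_row ?S = n" "dim_col ?S = n" using C by auto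
  have "(U * U\<^sup>T * ?S * (U * U\<^sup>T))\<^sup>T = ?S\<^sup>T" unfolding P by simp
  then have "U * U\<^sup>T * ?S\<^sup>T * (U * U\<^sup>T) = ?S\<^sup>T" by (simp add: mat_algebra)
  moreover have "\<Sigma> * ?S\<^sup>T + ?S\<^sup>T * \<Sigma> = U * U\<^sup>T * V * (U * U\<^sup>T)"
  proof -
    have "\<Sigma> * ?S\<^sup>T + ?S\<^sup>T * \<Sigma> = ?S\<^sup>T * \<Sigma> + \<Sigma> * ?S\<^sup>T"
      by (rule comm_add_mat[of _ n n]) (rule carrier_matI, simp_all add: \<Sigma>)+
    also have "\<dots> = (\<Sigma> * ?S + ?S * \<Sigma>)\<^sup>T" using \<Sigma> by (simp add: mat_algebra)
    also have "\<dots> = U * U\<^sup>T * V * (U * U\<^sup>T)" unfolding E by (simp add: mat_algebra sym)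
    finally show ?thesis .
  qed
  ultimately show "?S\<^sup>T = ?S" using S_mat_eqI[OF dec V, of "?S\<^sup>T"] C by (metis transpose_carrier_mat)
qed

section \<open>Curves of matrices\<close>

lemma smooth_real_on_affine: "smooth_real_on I (\<lambda>t. a + t * b)"
proof -
  let ?D = "\<lambda>(m :: nat) t. if m = 0 then a + t * b else if m = 1 then b else 0"
  have "?D 0 = (\<lambda>t. a + t * b)" by simp
  moreover have "(?D m has_real_derivative ?D (Suc m) t) (at t)" for m t
  proof -
    consider "m = 0" | "m = 1" | "m > 1" by linarith
    then show ?thesis by cases (auto intro!: derivative_eq_intros)
  qed
  ultimately show ?thesis unfolding smooth_real_on_def by (intro exI[of _ ?D]) simp
qed

text \<open>The determinant is a polynomial in the entries, so it is continuous along a line.\<close>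
lemma det_affine_nonzero_near:
  fixes A B :: "real mat"
  assumes A: "A \<in> carrier_mat k k" and B: "B \<in> carrier_mat k k" and d: "det A \<noteq> 0"
  obtains \<epsilon> where "0 < \<epsilon>" "\<And>t. \<bar>t\<bar> < \<epsilon> \<Longrightarrow> det (A + t \<cdot>\<^sub>m B) \<noteq> 0"
proof -
  have "det (A + t \<cdot>\<^sub>m B) = (\<Sum>p\<in>{p. p permutes {0..<k}}. signof p *
      (\<Prod>i=0..<k. A $$ (i, p i) + t * B $$ (i, p i)))" for t
    using A B unfolding det_def by (auto intro!: sum.cong prod.cong)
  then have "isCont (\<lambda>t. det (A + t \<cdot>\<^sub>m B)) 0" by (simp add: continuous_intros)
  moreover have "A + 0 \<cdot>\<^sub>m B = A" using A B by (intro eq_matI) auto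
  ultimately have "eventually (\<lambda>t. det (A + t \<cdot>\<^sub>m B) \<noteq> 0) (at 0)"
    using d by (intro tendsto_imp_eventually_ne[where c = "det A"]) (simp_all add: isCont_def)
  then obtain \<epsilon> where "0 < \<epsilon>" "\<And>t. t \<noteq> 0 \<Longrightarrow> \<bar>t\<bar> < \<epsilon> \<Longrightarrow> det (A + t \<cdot>\<^sub>m B) \<noteq> 0"
    by (auto simp: eventually_at dist_real_def)
  then show ?thesis using that[of \<epsilon>] d \<open>A + 0 \<cdot>\<^sub>m B = A\<close> by metis
qed

text \<open>A smooth curve in \<open>Sym_plus\<close> is locally \<open>Y(t) Y(t)\<^sup>T\<close> with \<open>Y\<close> smooth; the product rule gives its
  velocity.\<close>
lemma tangent_vector_lift:
  assumes V: "V \<in> tangent_space n k \<Sigma>"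
  obtains Y W where "Y \<in> full_rank_mat n k" "proj Y = \<Sigma>" "W \<in> carrier_mat n k" "V = d_proj Y W"
proof -
  obtain \<gamma> \<epsilon> where VC: "V \<in> carrier_mat n n" and \<epsilon>: "0 < \<epsilon>" and \<gamma>0: "\<gamma> 0 = \<Sigma>"
    and \<gamma>: "smooth_curve_Sym_plus n k {-\<epsilon><..<\<epsilon>} \<gamma>"
    and d\<gamma>: "\<And>i j. i < n \<Longrightarrow> j < n \<Longrightarrow> ((\<lambda>t. \<gamma> t $$ (i, j)) has_real_derivative V $$ (i, j)) (at 0)"
    using V unfolding tangent_space_def by blast
  have "0 \<in> {-\<epsilon><..<\<epsilon>}" using \<epsilon> by simp
  then obtain J c where J: "open J" "0 \<in> J" and c: "smooth_curve_full_rank n k J c"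
    and \<gamma>c: "\<And>t. t \<in> J \<Longrightarrow> \<gamma> t = proj (c t)"
    using \<gamma> unfolding smooth_curve_Sym_plus_def by meson
  have "\<exists>d. ((\<lambda>t. c t $$ (i, j)) has_real_derivative d) (at 0)" if ij: "i < n" "j < k" for i j
  proof -
    obtain E :: "nat \<Rightarrow> real \<Rightarrow> real" where "E 0 = (\<lambda>t. c t $$ (i, j))"
      "(E 0 has_real_derivative E (Suc 0) 0) (at 0)"
      using c ij J(2) unfolding smooth_curve_full_rank_def smooth_real_on_def by meson
    then show ?thesis by auto
  qed
  then obtain w where w: "\<And>i j. i < n \<Longrightarrow> j < k \<Longrightarrow> ((\<lambda>t. c t $$ (i, j)) has_real_derivative w i j) (at 0)"
    by metis
  define W where "W = mat n k (\<lambda>(i, j). w i j)"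
  have cC: "c t \<in> carrier_mat n k" if "t \<in> J" for t
    using c that by (auto simp: smooth_curve_full_rank_def full_rank_mat_def)
  have "V = d_proj (c 0) W"
  proof (intro eq_matI)
    fix i j assume "i < dim_row (d_proj (c 0) W)" "j < dim_col (d_proj (c 0) W)"
    then have ij: "i < n" "j < n" using cC[OF J(2)] by (auto simp: d_proj_def W_def)
    have "((\<lambda>t. \<Sum>l<k. c t $$ (i, l) * c t $$ (j, l)) has_real_derivative
        (\<Sum>l<k. c 0 $$ (i, l) * w j l + w i l * c 0 $$ (j, l))) (at 0)"
      using w ij by (auto intro!: derivative_eq_intros sum.cong)
    then have "((\<lambda>t. \<gamma> t $$ (i, j)) has_real_derivative
        (\<Sum>l<k. c 0 $$ (i, l) * w j l + w i l * c 0 $$ (j, l))) (at 0)"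
    proof (rule has_field_derivative_transform_within_open[OF _ J])
      fix t assume t: "t \<in> J"
      show "(\<Sum>l<k. c t $$ (i, l) * c t $$ (j, l)) = \<gamma> t $$ (i, j)"
        using cC[OF t] ij by (simp add: \<gamma>c[OF t] proj_def scalar_prod_def lessThan_atLeast0)
    qed
    then have "V $$ (i, j) = (\<Sum>l<k. c 0 $$ (i, l) * w j l + w i l * c 0 $$ (j, l))"
      using DERIV_unique[OF d\<gamma>[OF ij]] by blast
    then show "V $$ (i, j) = d_proj (c 0) W $$ (i, j)"
      using cC[OF J(2)] ij by (simp add: d_proj_def W_def scalar_prod_def lessThan_atLeast0 sum.distrib)
  qed (use VC cC[OF J(2)] in \<open>auto simp: d_proj_def W_def\<close>)
  moreover have "c 0 \<in> full_rank_mat n k" using c J(2) by (auto simp: smooth_curve_full_rank_def)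
  moreover have "proj (c 0) = \<Sigma>" using \<gamma>c[OF J(2)] \<gamma>0 by simp
  moreover have "W \<in> carrier_mat n k" by (simp add: W_def)
  ultimately show ?thesis using that by blast
qed

section \<open>Points of a fibre and the projector onto the range\<close>

text \<open>A point \<open>X\<close> of the fibre of \<open>proj\<close> over \<open>X X\<^sup>T\<close>. The complement \<open>Xp\<close> is a parameter of its own because
  the same \<open>Xp\<close> serves all points of the fibre.\<close>
locale fibre_point =
  fixes n k :: nat and X Xp :: "real mat"
  assumes k_le_n: "k \<le> n" and X: "X \<in> full_rank_mat n k" and Xp: "is_orth_complement n k X Xp"
begin

abbreviation Gram_inv :: "real mat" where "Gram_inv \<equiv> inverse_mat (X\<^sup>T * X)"

abbreviation range_proj :: "real mat" where "range_proj \<equiv> X * Gram_inv * X\<^sup>T"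

lemma X_carrier: "X \<in> carrier_mat n k"
  using X by (simp add: full_rank_mat_def)

lemma Xp_carrier: "Xp \<in> carrier_mat n (n - k)"
  using Xp by (simp add: is_orth_complement_def Stiefel_def)

lemma Gram_inverse: "Gram_inv \<in> carrier_mat k k" "X\<^sup>T * X * Gram_inv = 1\<^sub>m k" "Gram_inv * (X\<^sup>T * X) = 1\<^sub>m k"
proof -
  have "X\<^sup>T * X \<in> carrier_mat k k" using X_carrier by auto
  from inverse_mat_nonsingular[OF this det_Gram_neq_0[OF X]]
  show "Gram_inv \<in> carrier_mat k k" "X\<^sup>T * X * Gram_inv = 1\<^sub>m k" "Gram_inv * (X\<^sup>T * X) = 1\<^sub>m k" by auto
qed

lemma dims [simp]: "dim_row X = n" "dim_col X = k" "dim_row Xp = n" "dim_col Xp = n - k"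
  "dim_row Gram_inv = k" "dim_col Gram_inv = k"
  using X_carrier Xp_carrier Gram_inverse(1) by auto

lemma Gram_inv_sym: "Gram_inv\<^sup>T = Gram_inv"
proof -
  have "Gram_inv\<^sup>T = Gram_inv\<^sup>T * (X\<^sup>T * X * Gram_inv)" by (simp add: Gram_inverse(2) mult_one_dim)
  also have "\<dots> = (X\<^sup>T * X * Gram_inv)\<^sup>T * Gram_inv" by (simp add: mat_algebra)
  also have "\<dots> = Gram_inv" by (simp add: Gram_inverse(2) one_mult_dim)
  finally show ?thesis .
qed

lemma Gram_cancel:
  "X\<^sup>T * (X * Gram_inv) = 1\<^sub>m k" "Gram_inv * (X\<^sup>T * X) = 1\<^sub>m k"
  "dim_row M = k \<Longrightarrow> X\<^sup>T * (X * (Gram_inv * M)) = M" "dim_row M = k \<Longrightarrow> Gram_inv * (X\<^sup>T * (X * M)) = M"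
proof -
  show 1: "X\<^sup>T * (X * Gram_inv) = 1\<^sub>m k" using Gram_inverse(2) by (simp add: mult_assoc_dim)
  show 2: "Gram_inv * (X\<^sup>T * X) = 1\<^sub>m k" by (rule Gram_inverse(3))
  show "X\<^sup>T * (X * (Gram_inv * M)) = M" if "dim_row M = k"
    using mult_eq_extend[OF 1, of M] that by (simp add: mult_assoc_dim one_mult_dim)
  show "Gram_inv * (X\<^sup>T * (X * M)) = M" if "dim_row M = k"
    using mult_eq_extend[OF 2, of M] that by (simp add: mult_assoc_dim one_mult_dim)
qed

lemma complement_cancel:
  "Xp\<^sup>T * Xp = 1\<^sub>m (n - k)" "X\<^sup>T * Xp = 0\<^sub>m k (n - k)" "Xp\<^sup>T * X = 0\<^sub>m (n - k) k"
  "dim_row M = n - k \<Longrightarrow> Xp\<^sup>T * (Xp * M) = M"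
  "dim_row M = n - k \<Longrightarrow> X\<^sup>T * (Xp * M) = 0\<^sub>m k (dim_col M)"
  "dim_row M = k \<Longrightarrow> Xp\<^sup>T * (X * M) = 0\<^sub>m (n - k) (dim_col M)"
proof -
  show 1: "Xp\<^sup>T * Xp = 1\<^sub>m (n - k)" "X\<^sup>T * Xp = 0\<^sub>m k (n - k)"
    using Xp by (auto simp: is_orth_complement_def Stiefel_def)
  show 3: "Xp\<^sup>T * X = 0\<^sub>m (n - k) k"
    using arg_cong[OF 1(2), of transpose_mat] by (simp add: transpose_mult_dim)
  show "dim_row M = n - k \<Longrightarrow> Xp\<^sup>T * (Xp * M) = M"
    using mult_eq_extend[OF 1(1), of M] by (simp add: mat_algebra)
  show "dim_row M = n - k \<Longrightarrow> X\<^sup>T * (Xp * M) = 0\<^sub>m k (dim_col M)"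
    using mult_eq_extend[OF 1(2), of M] by (simp add: mat_algebra)
  show "dim_row M = k \<Longrightarrow> Xp\<^sup>T * (X * M) = 0\<^sub>m (n - k) (dim_col M)"
    using mult_eq_extend[OF 3, of M] by (simp add: mat_algebra)
qed

lemmas fibre_algebra = mat_algebra Gram_inv_sym Gram_cancel complement_cancel

lemma complement_proj: "Xp * Xp\<^sup>T = 1\<^sub>m n - range_proj"
  using orth_projectors_complementary[OF X_carrier Xp_carrier Gram_inverse(1) _ Gram_inv_sym Gram_inverse(2)
      complement_cancel(1,2)] k_le_n by simp

text \<open>The matrix \<open>(X\<^sup>T Y)\<^sup>-\<^sup>1 X\<^sup>T\<close> is a left inverse of \<open>Y\<close>. Since \<open>X\<^sup>T X\<close> is invertible, this applies to all \<open>Y\<close> near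
  \<open>X\<close>.\<close>
lemma full_rank_if_det_neq_0:
  assumes Y: "Y \<in> carrier_mat n k" and d: "det (X\<^sup>T * Y) \<noteq> 0"
  shows "Y \<in> full_rank_mat n k"
proof (rule full_rank_if_left_inverse[OF Y, of "inverse_mat (X\<^sup>T * Y) * X\<^sup>T"])
  have c: "X\<^sup>T * Y \<in> carrier_mat k k" using Y X_carrier by auto
  note I = inverse_mat_nonsingular[OF c d]
  show "inverse_mat (X\<^sup>T * Y) * X\<^sup>T \<in> carrier_mat k n" using I X_carrier by auto
  have "dim_col (inverse_mat (X\<^sup>T * Y)) = k" using I by auto
  then show "inverse_mat (X\<^sup>T * Y) * X\<^sup>T * Y = 1\<^sub>m k" using I Y by (simp add: mult_assoc_dim)
qed

lemma moore_penrose_Gram: "moore_penrose (X * X\<^sup>T) = X * Gram_inv * Gram_inv * X\<^sup>T"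
proof (rule moore_penroseI)
  let ?A = "X * X\<^sup>T" and ?P = "X * Gram_inv * Gram_inv * X\<^sup>T"
  show "?P \<in> carrier_mat (dim_col ?A) (dim_row ?A)" by (rule carrier_matI) simp_all
  have AP: "?A * ?P = X * (Gram_inv * X\<^sup>T)" by (simp add: fibre_algebra)
  have PA: "?P * ?A = X * (Gram_inv * X\<^sup>T)" by (simp add: fibre_algebra)
  show "?A * ?P * ?A = ?A" unfolding AP by (simp add: fibre_algebra)
  show "?P * ?A * ?P = ?P" unfolding PA by (simp add: fibre_algebra)
  show "(?A * ?P)\<^sup>T = ?A * ?P" unfolding AP by (simp add: fibre_algebra)
  show "(?P * ?A)\<^sup>T = ?P * ?A" unfolding PA by (simp add: fibre_algebra)
qed

text \<open>The complement is orthogonal to \<open>Y\<close> since \<open>|Y\<^sup>T Xp|\<^sup>2 = tr (Xp\<^sup>T Y Y\<^sup>T Xp)\<close> depends on \<open>Y Y\<^sup>T\<close> only.\<close>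
lemma fibre_point_transport:
  assumes Y: "Y \<in> full_rank_mat n k" and eq: "proj Y = proj X"
  shows "fibre_point n k Y Xp"
proof
  have [simp]: "dim_row Y = n" "dim_col Y = k" using Y by (auto simp: full_rank_mat_def)
  have "(Y\<^sup>T * Xp)\<^sup>T * (Y\<^sup>T * Xp) = Xp\<^sup>T * proj Y * Xp" by (simp add: proj_def mat_algebra)
  also have "\<dots> = 0\<^sub>m (n - k) (n - k)" unfolding eq by (simp add: proj_def fibre_algebra)
  finally have "frobenius_inner (Y\<^sup>T * Xp) (Y\<^sup>T * Xp) = 0" by (simp add: frobenius_inner_def)
  then have "Y\<^sup>T * Xp = 0\<^sub>m k (n - k)" using frobenius_inner_self_eq_0[of "Y\<^sup>T * Xp"] by simp
  then show "is_orth_complement n k Y Xp" using Xp by (simp add: is_orth_complement_def)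
qed (use k_le_n Y in auto)

lemma decomposition_range:
  assumes dec: "is_decomposition n k (X * X\<^sup>T) U D" shows "U * U\<^sup>T = range_proj"
proof -
  note d = decompositionD[OF dec]
  have [simp]: "dim_row U = n" "dim_col U = k" "dim_row D = k" "dim_col D = k" using d(1,4) by auto
  \<comment> \<open>\<open>Xp\<close> kills \<open>X X\<^sup>T = U D U\<^sup>T\<close>, and \<open>D\<close> is injective, so \<open>Xp\<close> is orthogonal to \<open>U\<close> as well.\<close>
  have "D * (U\<^sup>T * Xp) = (U\<^sup>T * U) * (D * (U\<^sup>T * Xp))" unfolding d(5) by (simp add: mat_algebra)
  also have "\<dots> = U\<^sup>T * ((X * X\<^sup>T) * Xp)" unfolding d(6) by (simp add: mult_assoc_dim)
  also have "\<dots> = 0\<^sub>m k (n - k)" by (simp add: fibre_algebra)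
  finally have D0: "D * (U\<^sup>T * Xp) = 0\<^sub>m k (n - k)" .
  have UXp: "U\<^sup>T * Xp = 0\<^sub>m k (n - k)"
  proof (intro eq_matI)
    fix i j assume "i < dim_row (0\<^sub>m k (n - k) :: real mat)" "j < dim_col (0\<^sub>m k (n - k) :: real mat)"
    then have ij: "i < k" "j < n - k" by auto
    have "D $$ (i, i) * (U\<^sup>T * Xp) $$ (i, j) = 0"
      using diagonal_mult_index[OF d(1,2), of "U\<^sup>T * Xp" "n - k" i j] ij D0
      by (simp add: carrier_matI del: index_mult_mat(1))
    then show "(U\<^sup>T * Xp) $$ (i, j) = 0\<^sub>m k (n - k) $$ (i, j)" using d(3) ij
      by (simp add: less_imp_neq[symmetric] del: index_mult_mat(1))
  qed simp_all
  have "Xp * Xp\<^sup>T = 1\<^sub>m n - U * 1\<^sub>m k * U\<^sup>T"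
    using orth_projectors_complementary[OF d(4) Xp_carrier, of "1\<^sub>m k"] k_le_n d(5) UXp complement_cancel(1)
    by (simp add: mat_algebra)
  then have "1\<^sub>m n - U * U\<^sup>T = 1\<^sub>m n - range_proj" using complement_proj by (simp add: mult_one_dim)
  moreover have "1\<^sub>m n - (1\<^sub>m n - M) = M" if "dim_row M = n" "dim_col M = n" for M :: "real mat"
    using that by (intro eq_matI) auto
  ultimately show ?thesis
    by (metis dims(1) index_mult_mat(2,3) index_transpose_mat(3) \<open>dim_row U = n\<close>)
qed

section \<open>The tangent space\<close>

text \<open>Of the four blocks of \<open>V\<close> with respect to the range and its complement, \<open>Q V Q\<close> is zero.\<close>
lemma split_blocks:
  assumes V: "V \<in> carrier_mat n n" and V0: "Xp\<^sup>T * V * Xp = 0\<^sub>m (n - k) (n - k)"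
  shows "V = range_proj * V * range_proj + (range_proj * V * (Xp * Xp\<^sup>T) + Xp * Xp\<^sup>T * V * range_proj)"
proof -
  have [simp]: "dim_row V = n" "dim_col V = n" using V by auto
  have Q0: "Xp * Xp\<^sup>T * V * (Xp * Xp\<^sup>T) = 0\<^sub>m n n"
    using mult_eq_extend[of "Xp\<^sup>T" "V * Xp" "0\<^sub>m (n - k) (n - k)" "Xp\<^sup>T"] V0 by (simp add: mat_algebra)
  have one: "range_proj + Xp * Xp\<^sup>T = 1\<^sub>m n" unfolding complement_proj by (intro eq_matI) auto
  have "V = (range_proj + Xp * Xp\<^sup>T) * V * (range_proj + Xp * Xp\<^sup>T)"
    unfolding one by (simp add: mat_algebra)
  also have "\<dots> = range_proj * V * range_proj + (range_proj * V * (Xp * Xp\<^sup>T) + Xp * Xp\<^sup>T * V * range_proj)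
      + Xp * Xp\<^sup>T * V * (Xp * Xp\<^sup>T)"
    by (simp add: mat_algebra) (intro eq_matI, simp_all del: index_mult_mat(1))
  finally show ?thesis unfolding Q0 by (simp add: add_zero_dim)
qed

text \<open>Once the block of \<open>V\<close> on the range is produced by some \<open>T\<close>, the mixed blocks come from the one additional
  summand \<open>Q V X G\<^sup>-\<^sup>1\<close>. Both the tangent space and the horizontal lift use this, with different choices of \<open>T\<close>.\<close>
lemma d_proj_add_cross_term:
  assumes V: "V \<in> carrier_mat n n" "V\<^sup>T = V" and V0: "Xp\<^sup>T * V * Xp = 0\<^sub>m (n - k) (n - k)"
    and T: "T \<in> carrier_mat n k" "d_proj X T = range_proj * V * range_proj"
  shows "d_proj X (T + Xp * Xp\<^sup>T * V * X * Gram_inv) = V"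
proof -
  have [simp]: "dim_row V = n" "dim_col V = n" "dim_row T = n" "dim_col T = k" using V(1) T(1) by auto
  have "d_proj X (T + Xp * Xp\<^sup>T * V * X * Gram_inv)
      = d_proj X T + (range_proj * V * (Xp * Xp\<^sup>T) + Xp * Xp\<^sup>T * V * range_proj)"
    by (simp add: d_proj_def fibre_algebra V(2)) (intro eq_matI, simp_all del: index_mult_mat(1))
  also have "\<dots> = V" unfolding T(2) using split_blocks[OF V(1) V0] by simp
  finally show ?thesis .
qed

lemma d_proj_tangent:
  assumes W: "W \<in> carrier_mat n k"
  shows "d_proj X W \<in> tangent_space n k (proj X)"
proof -
  have [simp]: "dim_row W = n" "dim_col W = k" using W by auto
  define c where "c t = X + t \<cdot>\<^sub>m W" for t
  have cC: "c t \<in> carrier_mat n k" for t unfolding c_def by (rule carrier_matI) simp_all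
  have "X\<^sup>T * X \<in> carrier_mat k k" "X\<^sup>T * W \<in> carrier_mat k k" by (rule carrier_matI, simp, simp)+
  then obtain \<epsilon> where \<epsilon>: "0 < \<epsilon>" "\<And>t. \<bar>t\<bar> < \<epsilon> \<Longrightarrow> det (X\<^sup>T * X + t \<cdot>\<^sub>m (X\<^sup>T * W)) \<noteq> 0"
    using det_affine_nonzero_near det_Gram_neq_0[OF X] by metis
  have "X\<^sup>T * c t = X\<^sup>T * X + t \<cdot>\<^sub>m (X\<^sup>T * W)" for t by (simp add: c_def mat_algebra)
  then have full: "c t \<in> full_rank_mat n k" if "t \<in> {-\<epsilon><..<\<epsilon>}" for t
    using full_rank_if_det_neq_0[OF cC] \<epsilon>(2)[of t] that by (simp add: abs_less_iff)
  have "smooth_real_on {-\<epsilon><..<\<epsilon>} (\<lambda>t. c t $$ (i, j))" if "i < n" "j < k" for i j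
    using that smooth_real_on_affine[of _ "X $$ (i, j)" "W $$ (i, j)"] by (simp add: c_def)
  then have "smooth_curve_full_rank n k {-\<epsilon><..<\<epsilon>} c"
    using full by (simp add: smooth_curve_full_rank_def)
  then have "smooth_curve_Sym_plus n k {-\<epsilon><..<\<epsilon>} (\<lambda>t. proj (c t))"
    unfolding smooth_curve_Sym_plus_def
    by (intro conjI ballI exI[of _ "{-\<epsilon><..<\<epsilon>}"] exI[of _ c]) (simp_all add: full proj_in_Sym_plus)
  moreover have "c 0 = X" unfolding c_def by (intro eq_matI) auto
  moreover have "((\<lambda>t. proj (c t) $$ (i, j)) has_real_derivative d_proj X W $$ (i, j)) (at 0)"
    if "i < n" "j < n" for i j
    unfolding c_def by (rule d_proj_is_derivative[OF X_carrier W that])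
  moreover have "d_proj X W \<in> carrier_mat n n" unfolding d_proj_def by (rule carrier_matI) simp_all
  ultimately show ?thesis using \<epsilon>(1)
    unfolding tangent_space_def by (intro CollectI conjI exI[of _ "\<lambda>t. proj (c t)"] exI[of _ \<epsilon>]) simp_all
qed

lemma tangent_space_eq:
  "tangent_space n k (proj X) = {V \<in> Sym n. Xp\<^sup>T * V * Xp = 0\<^sub>m (n - k) (n - k)}"
proof (intro equalityI subsetI)
  fix V assume "V \<in> tangent_space n k (proj X)"
  then obtain Y W where Y: "Y \<in> full_rank_mat n k" "proj Y = proj X" and W: "W \<in> carrier_mat n k"
    and V: "V = d_proj Y W" by (rule tangent_vector_lift)
  \<comment> \<open>The curve may be lifted through a point \<open>Y\<close> of the fibre other than \<open>X\<close>.\<close>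
  interpret Y: fibre_point n k Y Xp by (rule fibre_point_transport[OF Y])
  have [simp]: "dim_row W = n" "dim_col W = k" using W by auto
  have "V \<in> carrier_mat n n" unfolding V d_proj_def by (rule carrier_matI) simp_all
  moreover have "V\<^sup>T = V"
    unfolding V d_proj_def by (simp add: mat_algebra) (intro eq_matI, simp_all del: index_mult_mat(1))
  moreover have "Xp\<^sup>T * V * Xp = 0\<^sub>m (n - k) (n - k)"
    unfolding V d_proj_def by (simp add: Y.fibre_algebra)
  ultimately show "V \<in> {V \<in> Sym n. Xp\<^sup>T * V * Xp = 0\<^sub>m (n - k) (n - k)}" by (simp add: Sym_def)
next
  fix V assume "V \<in> {V \<in> Sym n. Xp\<^sup>T * V * Xp = 0\<^sub>m (n - k) (n - k)}"
  then have V: "V \<in> carrier_mat n n" "V\<^sup>T = V" "Xp\<^sup>T * V * Xp = 0\<^sub>m (n - k) (n - k)"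
    by (auto simp: Sym_def)
  have [simp]: "dim_row V = n" "dim_col V = n" using V(1) by auto
  \<comment> \<open>The factor \<open>1/2\<close> is there because \<open>d_proj X\<close> produces the block \<open>P V P\<close> once from each summand.\<close>
  let ?T = "(1/2) \<cdot>\<^sub>m (range_proj * V * X * Gram_inv)"
  have T: "?T \<in> carrier_mat n k" by (rule carrier_matI) simp_all
  have "d_proj X ?T = range_proj * V * range_proj"
    by (simp add: d_proj_def fibre_algebra V(2)) (intro eq_matI, simp_all del: index_mult_mat(1))
  from d_proj_add_cross_term[OF V T this]
  have "d_proj X (?T + Xp * Xp\<^sup>T * V * X * Gram_inv) = V" .
  moreover have "?T + Xp * Xp\<^sup>T * V * X * Gram_inv \<in> carrier_mat n k" by (rule carrier_matI) simp_all
  ultimately show "V \<in> tangent_space n k (proj X)" using d_proj_tangent by metis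
qed

section \<open>The horizontal lift\<close>

text \<open>Multiply \<open>X Z\<^sup>T + Z X\<^sup>T = 0\<close> by \<open>Xp\<^sup>T\<close> on the left and cancel \<open>X\<^sup>T\<close> on the right.\<close>
lemma vertical_orth_complement:
  assumes Z: "Z \<in> vertical_space n k X" shows "Xp\<^sup>T * Z = 0\<^sub>m (n - k) k"
proof -
  have ZC: "Z \<in> carrier_mat n k" and Z0: "X * Z\<^sup>T + Z * X\<^sup>T = 0\<^sub>m n n"
    using Z by (auto simp: vertical_space_def d_proj_def)
  have [simp]: "dim_row Z = n" "dim_col Z = k" using ZC by auto
  have "Xp\<^sup>T * Z = Xp\<^sup>T * (X * Z\<^sup>T + Z * X\<^sup>T) * X * Gram_inv" by (simp add: fibre_algebra)
  also have "\<dots> = 0\<^sub>m (n - k) k" unfolding Z0 by (simp add: mat_algebra)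
  finally show ?thesis .
qed

text \<open>Against a vertical \<open>Z\<close>, the second summand vanishes because \<open>Z\<^sup>T Xp = 0\<close>, and the first because \<open>X Z\<^sup>T\<close>
  is skew-symmetric while \<open>S\<close> is symmetric.\<close>
lemma horizontalI:
  assumes S: "S \<in> carrier_mat n n" "S\<^sup>T = S" and M: "M \<in> carrier_mat (n - k) k"
  shows "S * X + Xp * M \<in> horizontal_space n k X"
  unfolding horizontal_space_def
proof (intro CollectI conjI ballI)
  have [simp]: "dim_row S = n" "dim_col S = n" "dim_row M = n - k" "dim_col M = k" using S(1) M by auto
  show "S * X + Xp * M \<in> carrier_mat n k" by (rule carrier_matI) simp_all
  fix Z assume Z: "Z \<in> vertical_space n k X"
  then have ZC: "Z \<in> carrier_mat n k" and Z0: "X * Z\<^sup>T + Z * X\<^sup>T = 0\<^sub>m n n"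
    by (auto simp: vertical_space_def d_proj_def)
  have [simp]: "dim_row Z = n" "dim_col Z = k" using ZC by auto
  have ZXp: "Z\<^sup>T * Xp = 0\<^sub>m k (n - k)"
    using arg_cong[OF vertical_orth_complement[OF Z], of transpose_mat] by (simp add: mat_algebra)
  \<comment> \<open>The trace against \<open>S X\<close> is computed twice, the second time through its transpose; the two
    results add up to the trace of \<open>S (X Z\<^sup>T + Z X\<^sup>T) = 0\<close>.\<close>
  have t1: "trace (Z\<^sup>T * (S * X)) = trace (S * (X * Z\<^sup>T))"
    using trace_mult_commute[of "Z\<^sup>T" "S * X"] by (simp add: mult_assoc_dim)
  have "trace (Z\<^sup>T * (S * X)) = trace ((Z\<^sup>T * (S * X))\<^sup>T)" by (simp add: trace_transpose)
  also have "\<dots> = trace (X\<^sup>T * (S * Z))" by (simp add: mat_algebra S(2))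
  also have "\<dots> = trace (S * (Z * X\<^sup>T))"
    using trace_mult_commute[of "X\<^sup>T" "S * Z"] by (simp add: mult_assoc_dim)
  finally have "2 * trace (Z\<^sup>T * (S * X)) = trace (S * (X * Z\<^sup>T)) + trace (S * (Z * X\<^sup>T))"
    using t1 by simp
  also have "\<dots> = trace (S * (X * Z\<^sup>T + Z * X\<^sup>T))" by (simp add: mult_add_dim trace_add)
  also have "\<dots> = 0" unfolding Z0 by (simp add: mat_algebra)
  finally have "trace (Z\<^sup>T * (S * X)) = 0" by simp
  moreover have "Z\<^sup>T * (S * X + Xp * M) = Z\<^sup>T * (S * X)"
    by (simp add: mat_algebra mult_eq_extend[OF ZXp])
  ultimately show "frobenius_inner Z (S * X + Xp * M) = 0" by (simp add: frobenius_inner_def)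
qed

lemma horizontal_liftI:
  assumes W: "W \<in> horizontal_space n k X" "d_proj X W = V"
  shows "horizontal_lift n k X V = W"
  unfolding horizontal_lift_def
proof (rule the_equality)
  fix W' assume W': "W' \<in> horizontal_space n k X \<and> d_proj X W' = V"
  have [simp]: "dim_row W = n" "dim_col W = k" "dim_row W' = n" "dim_col W' = k"
    using W W' by (auto simp: horizontal_space_def)
  let ?E = "W' - W"
  \<comment> \<open>The difference of two horizontal lifts is both vertical and horizontal, hence orthogonal to itself.\<close>
  have "d_proj X ?E = d_proj X W' - d_proj X W"
    by (simp add: d_proj_def mat_algebra) (intro eq_matI, simp_all del: index_mult_mat(1))
  also have "\<dots> = 0\<^sub>m n n" using W(2) W' by (auto simp: d_proj_def)
  finally have "?E \<in> vertical_space n k X" by (auto simp: vertical_space_def intro!: carrier_matI)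
  then have "frobenius_inner ?E W' = 0" "frobenius_inner ?E W = 0"
    using W(1) W' by (auto simp: horizontal_space_def)
  then have "frobenius_inner ?E ?E = 0"
    by (simp add: frobenius_inner_def mult_minus_dim trace_minus)
  then have "?E = 0\<^sub>m n k" using frobenius_inner_self_eq_0[of ?E] by simp
  then have "(W' - W) $$ (i, j) = 0" if "i < n" "j < k" for i j using that by simp
  then show "W' = W" by (intro eq_matI) auto
qed (use W in auto)

text \<open>Existence and uniqueness of the solution are those of \<open>S_mat\<close>, carried over from
  the coordinates of \<open>U\<close> to those of \<open>X\<close>.\<close>
lemma sylvester_Gram:
  assumes dec: "is_decomposition n k (X * X\<^sup>T) U D" and V: "V \<in> carrier_mat n n"
  shows "sylvester (X\<^sup>T * X) (X\<^sup>T * V * X) = X\<^sup>T * S_mat U D V * X"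
  unfolding sylvester_def
proof (rule the_equality)
  let ?S = "S_mat U D V"
  note P = decomposition_range[OF dec] and S = S_mat_props[OF dec V]
  have [simp]: "dim_row V = n" "dim_col V = n" "dim_row ?S = n" "dim_col ?S = n" using V S(1) by auto
  have "X\<^sup>T * (X * X\<^sup>T * ?S + ?S * (X * X\<^sup>T)) * X = X\<^sup>T * V * X"
    unfolding S(4) P by (simp add: fibre_algebra)
  then show "X\<^sup>T * ?S * X \<in> carrier_mat (dim_row (X\<^sup>T * X)) (dim_row (X\<^sup>T * X)) \<and>
      X\<^sup>T * X * (X\<^sup>T * ?S * X) + X\<^sup>T * ?S * X * (X\<^sup>T * X) = X\<^sup>T * V * X"
    by (simp add: mat_algebra carrier_matI)
  fix F assume F: "F \<in> carrier_mat (dim_row (X\<^sup>T * X)) (dim_row (X\<^sup>T * X)) \<and>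
      X\<^sup>T * X * F + F * (X\<^sup>T * X) = X\<^sup>T * V * X"
  have [simp]: "dim_row F = k" "dim_col F = k" using F by auto
  \<comment> \<open>Uniqueness: a solution \<open>F\<close> spreads out to the matrix \<open>?T\<close>, which has the properties that
    characterise \<open>S\<close>; compressing \<open>?T = S\<close> by \<open>X\<close> gives \<open>F\<close> back.\<close>
  let ?T = "X * Gram_inv * F * Gram_inv * X\<^sup>T"
  have "X * X\<^sup>T * ?T + ?T * (X * X\<^sup>T) = X * Gram_inv * (X\<^sup>T * X * F + F * (X\<^sup>T * X)) * Gram_inv * X\<^sup>T"
    by (simp add: fibre_algebra)
  also have "\<dots> = range_proj * V * range_proj"
    using F by (simp add: mat_algebra)
  finally have "?S = ?T"
    unfolding P[symmetric] using S_mat_eqI[OF dec V, of ?T]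
    unfolding P by (simp add: fibre_algebra carrier_matI)
  then show "F = X\<^sup>T * ?S * X" by (simp add: fibre_algebra)
qed

lemma horizontal_lift_S_mat:
  assumes dec: "is_decomposition n k (X * X\<^sup>T) U D"
    and V: "V \<in> Sym n" "Xp\<^sup>T * V * Xp = 0\<^sub>m (n - k) (n - k)"
  shows "horizontal_lift n k X V = S_mat U D V * X + Xp * (Xp\<^sup>T * V * X * Gram_inv)"
proof (rule horizontal_liftI)
  let ?S = "S_mat U D V"
  have VC: "V \<in> carrier_mat n n" "V\<^sup>T = V" using V(1) by (auto simp: Sym_def)
  note P = decomposition_range[OF dec] and S = S_mat_props[OF dec VC(1)] S_mat_props(5)[OF dec VC]
  have [simp]: "dim_row V = n" "dim_col V = n" "dim_row ?S = n" "dim_col ?S = n" using VC(1) S(1) by auto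
  show "?S * X + Xp * (Xp\<^sup>T * V * X * Gram_inv) \<in> horizontal_space n k X"
    by (rule horizontalI[OF S(1) S(6)]) (rule carrier_matI, simp_all)
  have "d_proj X (?S * X) = range_proj * V * range_proj"
    unfolding P[symmetric] S(4)[symmetric] by (simp add: d_proj_def mat_algebra S(6))
  from d_proj_add_cross_term[OF VC V(2) _ this]
  show "d_proj X (?S * X + Xp * (Xp\<^sup>T * V * X * Gram_inv)) = V"
    by (simp add: mult_assoc_dim carrier_matI)
qed

lemma horizontal_lift_sylvester:
  assumes dec: "is_decomposition n k (X * X\<^sup>T) U D"
    and V: "V \<in> Sym n" "Xp\<^sup>T * V * Xp = 0\<^sub>m (n - k) (n - k)"
  shows "horizontal_lift n k X V =
    X * Gram_inv * sylvester (X\<^sup>T * X) (X\<^sup>T * V * X) + Xp * Xp\<^sup>T * V * X * Gram_inv"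
proof -
  have VC: "V \<in> carrier_mat n n" using V(1) by (auto simp: Sym_def)
  note S = S_mat_props[OF dec VC]
  have [simp]: "dim_row V = n" "dim_col V = n" "dim_row (S_mat U D V) = n" "dim_col (S_mat U D V) = n"
    using VC S(1) by auto
  have "X * Gram_inv * (X\<^sup>T * S_mat U D V * X) = range_proj * S_mat U D V * X"
    by (simp add: mult_assoc_dim)
  also have "\<dots> = S_mat U D V * X" using S(2) unfolding decomposition_range[OF dec] by simp
  finally show ?thesis
    unfolding sylvester_Gram[OF dec VC] horizontal_lift_S_mat[OF dec V] by (simp add: mult_assoc_dim)
qed

section \<open>The Bures-Wasserstein metric\<close>

lemma S_mat_decomposition_independent:
  assumes dec: "is_decomposition n k (X * X\<^sup>T) U D" and dec': "is_decomposition n k (X * X\<^sup>T) U' D'"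
    and V: "V \<in> carrier_mat n n"
  shows "S_mat U' D' V = S_mat U D V"
proof (rule S_mat_eqI[OF dec' V])
  note P = decomposition_range[OF dec] decomposition_range[OF dec'] and S = S_mat_props[OF dec V]
  show "S_mat U D V \<in> carrier_mat n n" by (rule S)
  show "U' * U'\<^sup>T * S_mat U D V * (U' * U'\<^sup>T) = S_mat U D V"
    using S(2,3) unfolding P by simp
  show "X * X\<^sup>T * S_mat U D V + S_mat U D V * (X * X\<^sup>T) = U' * U'\<^sup>T * V * (U' * U'\<^sup>T)"
    using S(4) unfolding P .
qed

text \<open>The two summands of the lift are orthogonal because \<open>S Xp = 0\<close>: the matrix \<open>S\<close> is supported on the
  range of \<open>X\<close>.\<close>
lemma horizontal_lift_norm:
  assumes dec: "is_decomposition n k (X * X\<^sup>T) U D"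
    and V: "V \<in> Sym n" "Xp\<^sup>T * V * Xp = 0\<^sub>m (n - k) (n - k)"
  shows "frobenius_inner (horizontal_lift n k X V) (horizontal_lift n k X V) =
    trace (S_mat U D V * (X * X\<^sup>T) * S_mat U D V
      + V * moore_penrose (X * X\<^sup>T) * V * (1\<^sub>m n - U * U\<^sup>T))"
proof -
  let ?S = "S_mat U D V" and ?M = "Xp\<^sup>T * V * X * Gram_inv"
  have VC: "V \<in> carrier_mat n n" "V\<^sup>T = V" using V(1) by (auto simp: Sym_def)
  note P = decomposition_range[OF dec] and S = S_mat_props[OF dec VC(1)] S_mat_props(5)[OF dec VC]
  have [simp]: "dim_row V = n" "dim_col V = n" "dim_row ?S = n" "dim_col ?S = n" using VC(1) S(1) by auto
  have SXp: "?S * Xp = 0\<^sub>m n (n - k)"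
  proof -
    have "?S * Xp = ?S * range_proj * Xp" using S(3) unfolding P by simp
    then show ?thesis by (simp add: fibre_algebra)
  qed
  have XpS: "Xp\<^sup>T * ?S = 0\<^sub>m (n - k) n"
    using arg_cong[OF SXp, of transpose_mat] by (simp add: transpose_mult_dim S(6))
  have Q: "1\<^sub>m n - U * U\<^sup>T = Xp * Xp\<^sup>T" unfolding P complement_proj ..
  have "(?S * X + Xp * ?M)\<^sup>T * (?S * X + Xp * ?M) = X\<^sup>T * ?S * (?S * X) + ?M\<^sup>T * ?M"
    by (simp add: fibre_algebra VC(2) S(6) SXp XpS mult_eq_extend[OF SXp] mult_eq_extend[OF XpS])
  then have "frobenius_inner (horizontal_lift n k X V) (horizontal_lift n k X V)
      = trace (X\<^sup>T * ?S * (?S * X)) + trace (?M\<^sup>T * ?M)"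
    unfolding horizontal_lift_S_mat[OF dec V] frobenius_inner_def by (simp add: trace_add)
  also have "trace (X\<^sup>T * ?S * (?S * X)) = trace (?S * (X * X\<^sup>T) * ?S)"
    using trace_mult_commute[of "X\<^sup>T * ?S" "?S * X"] by (simp add: mult_assoc_dim)
  also have "?M\<^sup>T * ?M = (Gram_inv * X\<^sup>T * V * (Xp * Xp\<^sup>T)) * (V * X * Gram_inv)"
    by (simp add: fibre_algebra VC(2))
  also have "trace \<dots> = trace (V * X * Gram_inv * (Gram_inv * X\<^sup>T * V * (Xp * Xp\<^sup>T)))"
    by (rule trace_mult_commute) simp_all
  also have "V * X * Gram_inv * (Gram_inv * X\<^sup>T * V * (Xp * Xp\<^sup>T))
      = V * moore_penrose (X * X\<^sup>T) * V * (1\<^sub>m n - U * U\<^sup>T)"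
    unfolding Q moore_penrose_Gram by (simp add: mult_assoc_dim)
  finally show ?thesis unfolding Q moore_penrose_Gram by (simp add: trace_add)
qed

text \<open>The norm of the lift has the same value at every point of the fibre, so the definite description
  defining the metric denotes it.\<close>
lemma BW_metric_eq:
  assumes dec: "is_decomposition n k (X * X\<^sup>T) U D"
    and V: "V \<in> Sym n" "Xp\<^sup>T * V * Xp = 0\<^sub>m (n - k) (n - k)"
  shows "BW_metric n k (X * X\<^sup>T) V V =
    trace (S_mat U D V * (X * X\<^sup>T) * S_mat U D V
      + V * moore_penrose (X * X\<^sup>T) * V * (1\<^sub>m n - U * U\<^sup>T))" (is "_ = ?g")
proof -
  have norm: "frobenius_inner (horizontal_lift n k Y V) (horizontal_lift n k Y V) = ?g"
    if Y: "Y \<in> full_rank_mat n k" "proj Y = X * X\<^sup>T" for Y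
  proof -
    interpret Y: fibre_point n k Y Xp using fibre_point_transport[of Y] Y by (simp add: proj_def)
    show ?thesis using Y.horizontal_lift_norm[of U D V] dec V Y(2) by (simp add: proj_def)
  qed
  show ?thesis unfolding BW_metric_def
  proof (rule the_equality)
    show "\<forall>Y\<in>full_rank_mat n k. proj Y = X * X\<^sup>T \<longrightarrow>
        ?g = frobenius_inner (horizontal_lift n k Y V) (horizontal_lift n k Y V)"
      using norm by simp
    show "g = ?g" if "\<forall>Y\<in>full_rank_mat n k. proj Y = X * X\<^sup>T \<longrightarrow>
        g = frobenius_inner (horizontal_lift n k Y V) (horizontal_lift n k Y V)" for g
      using that X norm[OF X] by (simp add: proj_def)
  qed
qed

end

theorem theorem5p2:
  fixes n k :: nat and \<Sigma> X Xp V U D :: "real mat"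
  assumes "1 \<le> k" and "k \<le> n"
    and "\<Sigma> \<in> Sym_plus n k"
    and "X \<in> full_rank_mat n k" and "\<Sigma> = X * X\<^sup>T"
    and "is_orth_complement n k X Xp"
    and "V \<in> tangent_space n k \<Sigma>"
    and "is_decomposition n k \<Sigma> U D"
  shows "(\<forall>U' D'. is_decomposition n k \<Sigma> U' D' \<longrightarrow>
            S_mat U' D' V = S_mat U D V \<and> 1\<^sub>m n - U' * U'\<^sup>T = 1\<^sub>m n - U * U\<^sup>T)
       \<and> tangent_space n k \<Sigma> = {V' \<in> Sym n. Xp\<^sup>T * V' * Xp = 0\<^sub>m (n - k) (n - k)}
       \<and> horizontal_lift n k X V =
           X * inverse_mat (X\<^sup>T * X) * sylvester (X\<^sup>T * X) (X\<^sup>T * V * X)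
           + Xp * Xp\<^sup>T * V * X * inverse_mat (X\<^sup>T * X)
       \<and> Xp * Xp\<^sup>T = 1\<^sub>m n - X * inverse_mat (X\<^sup>T * X) * X\<^sup>T
       \<and> BW_metric n k \<Sigma> V V =
           trace (S_mat U D V * \<Sigma> * S_mat U D V
                  + V * moore_penrose \<Sigma> * V * (1\<^sub>m n - U * U\<^sup>T))"
proof -
  interpret fibre_point n k X Xp by (unfold_locales) (use assms in auto)
  have tangent: "tangent_space n k \<Sigma> = {V' \<in> Sym n. Xp\<^sup>T * V' * Xp = 0\<^sub>m (n - k) (n - k)}"
    using tangent_space_eq unfolding proj_def assms(5) .
  then have V: "V \<in> Sym n" "Xp\<^sup>T * V * Xp = 0\<^sub>m (n - k) (n - k)" using assms(7) by auto
  then have VC: "V \<in> carrier_mat n n" by (simp add: Sym_def)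
  note dec = assms(8)[unfolded assms(5)]
  show ?thesis
  proof (intro conjI allI impI tangent)
    fix U' D' assume "is_decomposition n k \<Sigma> U' D'"
    then have dec': "is_decomposition n k (X * X\<^sup>T) U' D'" unfolding assms(5) .
    show "S_mat U' D' V = S_mat U D V" by (rule S_mat_decomposition_independent[OF dec dec' VC])
    show "1\<^sub>m n - U' * U'\<^sup>T = 1\<^sub>m n - U * U\<^sup>T"
      unfolding decomposition_range[OF dec] decomposition_range[OF dec'] ..
  next
    show "horizontal_lift n k X V =
           X * inverse_mat (X\<^sup>T * X) * sylvester (X\<^sup>T * X) (X\<^sup>T * V * X)
           + Xp * Xp\<^sup>T * V * X * inverse_mat (X\<^sup>T * X)"
      by (rule horizontal_lift_sylvester[OF dec V])
    show "Xp * Xp\<^sup>T = 1\<^sub>m n - X * inverse_mat (X\<^sup>T * X) * X\<^sup>T" by (rule complement_proj)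
    show "BW_metric n k \<Sigma> V V = trace (S_mat U D V * \<Sigma> * S_mat U D V
                  + V * moore_penrose \<Sigma> * V * (1\<^sub>m n - U * U\<^sup>T))"
      unfolding assms(5) by (rule BW_metric_eq[OF dec V])
  qed
qed

end
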